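(* Let $m\ge1$ and $n\ge3$ be integers, let $-\Delta_m\in\mathbb{R}^{m\times m}$ be symmetric positive definite, let $T>0$, $\gamma>0$, $\tau=T/n$, $\alpha=\tau^2/\sqrt\gamma$, and let $$\mathcal{T}=B_n^{(1)}\otimes I_m-\tfrac{\tau^2}{2}B_n^{(2)}\otimes\Delta_m,\qquad \mathcal{A}=\begin{bmatrix}\alpha\check I_n\otimes I_m & \mathcal{T}^T\\ \mathcal{T} & -\alpha\hat I_n\otimes I_m\end{bmatrix},$$ $$S=S_n^{(1)}\otimes I_m-\tfrac{\tau^2}{2}S_n^{(2)}\otimes\Delta_m,\qquad \mathcal{P}_S=\begin{bmatrix}\sqrt{S^TS+\alpha^2I_{mn}} & \\ & \sqrt{SS^T+\alpha^2I_{mn}}\end{bmatrix}.$$ Then $$\mathcal{P}_S^{-1}\mathcal{A}=\widetilde{\mathcal{Q}}+\widetilde{\mathcal{R}}_0,$$ where $\widetilde{\mathcal{Q}}$ is both real symmetric and orthogonal and $\mathrm{rank}(\widetilde{\mathcal{R}}_0)\le 8m$.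
   Context: $B_n^{(1)}\in\mathbb{R}^{n\times n}$ is the lower triangular Toeplitz matrix with $1$ on the diagonal, $-2$ on the first subdiagonal, $1$ on the second subdiagonal and $0$ elsewhere. $B_n^{(2)}\in\mathbb{R}^{n\times n}$ is the lower triangular Toeplitz matrix with $1$ on the diagonal, $0$ on the first subdiagonal, $1$ on the second subdiagonal and $0$ elsewhere. $\hat I_n=\mathrm{diag}(\frac12,1,\dots,1)$ and $\check I_n=\mathrm{diag}(1,\dots,1,\frac12)$, both $n\times n$. $S_n^{(1)},S_n^{(2)}\in\mathbb{R}^{n\times n}$ are the circulant matrices whose first columns are $(1,-2,1,0,\dots,0)^T$ and $(1,0,1,0,\dots,0)^T$, respectively (i.e. $(i,j)$ entry $c_{(i-j)\bmod n}$ where $(c_0,\dots,c_{n-1})$ is the first column). $\sqrt{\cdot}$ is the symmetric positive semidefinite square root. *)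

theory Defs
  imports "HOL.NthRoot" "Jordan_Normal_Form.Gauss_Jordan_Elimination" "Jordan_Normal_Form.DL_Rank"
begin

definition symmetric_mat :: "'a mat \<Rightarrow> bool" where
  "symmetric_mat A \<longleftrightarrow> transpose_mat A = A"

definition pos_semidef_mat :: "real mat \<Rightarrow> bool" where
  "pos_semidef_mat A \<longleftrightarrow>
     square_mat A \<and> (\<forall>v \<in> carrier_vec (dim_row A). v \<bullet> (A *\<^sub>v v) \<ge> 0)"

definition pos_def_mat :: "real mat \<Rightarrow> bool" where
  "pos_def_mat A \<longleftrightarrow>
     square_mat A \<and> (\<forall>v \<in> carrier_vec (dim_row A). v \<noteq> 0\<^sub>v (dim_row A) \<longrightarrow> v \<bullet> (A *\<^sub>v v) > 0)"

(* The constant orthogonal_mat of the Matrix theory only asks for nonzero, pairwise orthogonal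
   columns; here the columns are orthonormal. *)
definition real_orthogonal_mat :: "real mat \<Rightarrow> bool" where
  "real_orthogonal_mat Q \<longleftrightarrow>
     square_mat Q \<and> transpose_mat Q * Q = 1\<^sub>m (dim_row Q) \<and> Q * transpose_mat Q = 1\<^sub>m (dim_row Q)"

(* Meaningful for symmetric positive semidefinite A, where the root exists and is unique. *)
definition psd_sqrt :: "real mat \<Rightarrow> real mat" where
  "psd_sqrt A = (THE B. B \<in> carrier_mat (dim_row A) (dim_row A) \<and>
     symmetric_mat B \<and> pos_semidef_mat B \<and> B * B = A)"

definition kron_mat :: "'a :: times mat \<Rightarrow> 'a mat \<Rightarrow> 'a mat" (infixl \<open>\<otimes>\<^sub>k\<close> 75) where
  "A \<otimes>\<^sub>k B = mat (dim_row A * dim_row B) (dim_col A * dim_col B)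
     (\<lambda>(i, j). A $$ (i div dim_row B, j div dim_col B) * B $$ (i mod dim_row B, j mod dim_col B))"

(* Both take the first column of the matrix. *)
definition lower_toeplitz_mat :: "'a :: zero vec \<Rightarrow> 'a mat" where
  "lower_toeplitz_mat c = mat (dim_vec c) (dim_vec c) (\<lambda>(i, j). if j \<le> i then c $ (i - j) else 0)"

definition circulant_mat :: "'a vec \<Rightarrow> 'a mat" where
  "circulant_mat c = mat (dim_vec c) (dim_vec c)
     (\<lambda>(i, j). c $ nat ((int i - int j) mod int (dim_vec c)))"

definition col1 :: "nat \<Rightarrow> real vec" where
  "col1 n = vec n (\<lambda>i. if i = 0 then 1 else if i = 1 then -2 else if i = 2 then 1 else 0)"

definition col2 :: "nat \<Rightarrow> real vec" where
  "col2 n = vec n (\<lambda>i. if i = 0 then 1 else if i = 2 then 1 else 0)"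

definition B1 :: "nat \<Rightarrow> real mat" where "B1 n = lower_toeplitz_mat (col1 n)"
definition B2 :: "nat \<Rightarrow> real mat" where "B2 n = lower_toeplitz_mat (col2 n)"
definition S1 :: "nat \<Rightarrow> real mat" where "S1 n = circulant_mat (col1 n)"
definition S2 :: "nat \<Rightarrow> real mat" where "S2 n = circulant_mat (col2 n)"

definition I_hat :: "nat \<Rightarrow> real mat" where
  "I_hat n = mat n n (\<lambda>(i, j). if i = j then (if i = 0 then 1/2 else 1) else 0)"

definition I_check :: "nat \<Rightarrow> real mat" where
  "I_check n = mat n n (\<lambda>(i, j). if i = j then (if i = n - 1 then 1/2 else 1) else 0)"

end

theory Submission
  imports Defs "Jordan_Normal_Form.Spectral_Radius"
begin

text \<open>
  Let \<open>A\<^sub>S\<close> be the matrix obtained from \<open>\<A>\<close> by replacing \<open>\<T>\<close> with \<open>S\<close> and both modified identities with the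
  identity. Then \<open>A\<^sub>S * A\<^sub>S = \<P> * \<P>\<close>, so \<open>A\<^sub>S\<close> commutes with the positive definite matrix \<open>\<P>\<close>, and
  \<open>Q = \<P>\<^sup>-\<^sup>1 * A\<^sub>S\<close> is symmetric with \<open>Q * Q = 1\<close>, hence orthogonal. The remainder \<open>\<P>\<^sup>-\<^sup>1 * (\<A> - A\<^sub>S)\<close>
  has nonzero columns only where the Toeplitz and circulant matrices differ, that is among \<open>4 * m\<close>
  consecutive columns around the block boundary.
\<close>

section \<open>Rank bound by counting nonzero columns\<close>

text \<open>The rank is the size of a maximal independent set of columns. Such a set omits the zero
  vector, so each of its members is a column indexed by \<open>J\<close>.\<close>

lemma rank_le_card_nonzero_cols:
  fixes A :: "'a :: field mat"
  assumes A: "A \<in> carrier_mat n nc" and "finite J"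
    and zero: "\<And>j. j < nc \<Longrightarrow> j \<notin> J \<Longrightarrow> col A j = 0\<^sub>v n"
  shows "vec_space.rank n A \<le> card J"
proof -
  interpret vec_space "TYPE('a)" n .
  obtain U where U: "maximal U (\<lambda>U. U \<subseteq> set (cols A) \<and> lin_indpt U)"
    using maximal_exists[of "\<lambda>U. U \<subseteq> set (cols A) \<and> lin_indpt U" "card (set (cols A))" "{}"]
    by (meson List.finite_set card_mono empty_iff empty_subsetI finite_lin_indpt2 rev_finite_subset)
  have UA: "U \<subseteq> set (cols A)" "lin_indpt U" using U unfolding maximal_def by auto
  have "U \<subseteq> carrier_vec n" using UA cols_dim[of A] A by auto
  from vs_zero_lin_dep[OF this UA(2)] have "0\<^sub>v n \<notin> U" by simp
  have "U \<subseteq> col A ` J"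
  proof
    fix u assume "u \<in> U"
    with UA obtain j where "j < nc" "u = col A j"
      using A by (auto simp: cols_def)
    moreover have "j \<in> J"
    proof (rule ccontr)
      assume "j \<notin> J"
      hence "u = 0\<^sub>v n" using zero \<open>j < nc\<close> \<open>u = col A j\<close> by simp
      thus False using \<open>u \<in> U\<close> \<open>0\<^sub>v n \<notin> U\<close> by simp
    qed
    ultimately show "u \<in> col A ` J" by simp
  qed
  hence "card U \<le> card J" using \<open>finite J\<close> by (meson card_image_le card_mono finite_imageI le_trans)
  with rank_card_indpt[OF A U] show ?thesis by simp
qed

section \<open>A Sylvester equation and the intertwining of squares\<close>

lemma scalar_prod_self_pos:
  fixes v :: "real vec"
  assumes "v \<in> carrier_vec n" "v \<noteq> 0\<^sub>v n"
  shows "v \<bullet> v > 0"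
  using conjugate_square_greater_0_vec[OF assms(1)] assms(2) by simp

text \<open>A trace argument, written out in entries: the trace of
  \<open>W * B * transpose_mat W\<close> is a sum of quadratic forms over the rows of
  \<open>W\<close>, hence nonnegative, while the equation makes it minus the trace of
  \<open>transpose_mat W * C * W\<close>, hence nonpositive. So every row form vanishes, and
  definiteness of \<open>B\<close> kills the row.\<close>

lemma sylvester_zero:
  fixes B C W :: "real mat"
  assumes B: "B \<in> carrier_mat n n" "symmetric_mat B" "pos_def_mat B"
    and C: "C \<in> carrier_mat k k" "pos_semidef_mat C"
    and W: "W \<in> carrier_mat k n" and eq: "W * B = - (C * W)"
  shows "W = 0\<^sub>m k n"
proof -
  have bnd: "\<And>v. v \<in> carrier_vec n \<Longrightarrow> v \<noteq> 0\<^sub>v n \<Longrightarrow> v \<bullet> (B *\<^sub>v v) > 0"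
    using B unfolding pos_def_mat_def by auto
  have B0: "row W i \<bullet> (B *\<^sub>v row W i) \<ge> 0" if "i < k" for i
    using bnd[of "row W i"] W that B by (cases "row W i = 0\<^sub>v n") (auto simp: less_imp_le)
  have C0: "col W j \<bullet> (C *\<^sub>v col W j) \<ge> 0" if "j < n" for j
    using C W that unfolding pos_semidef_mat_def by auto
  \<comment> \<open>Symmetry of \<open>B\<close> lets \<open>B *\<^sub>v row W i\<close> be read off
    as row \<open>i\<close> of \<open>W * B\<close>.\<close>
  have colB: "row B b = col B b" if "b < n" for b
    using B that unfolding symmetric_mat_def by (metis carrier_matD(1) row_transpose carrier_matD(2))
  have rowW: "row W i \<bullet> (B *\<^sub>v row W i) = (\<Sum>b<n. W $$ (i, b) * (W * B) $$ (i, b))" if i: "i < k" for i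
  proof -
    have "col B b \<bullet> row W i = row W i \<bullet> col B b" for b
      using W B(1) i by (intro comm_scalar_prod[of _ n]) auto
    thus ?thesis using W B(1) i colB
      by (auto simp: scalar_prod_def[of "row W i"  "B *\<^sub>v row W i"] atLeast0LessThan intro!: sum.cong)
  qed
  have colW: "col W j \<bullet> (C *\<^sub>v col W j) = (\<Sum>i<k. W $$ (i, j) * (C * W) $$ (i, j))" if j: "j < n" for j
    using W C(1) j
    by (auto simp: scalar_prod_def[of "col W j" "C *\<^sub>v col W j"] atLeast0LessThan intro!: sum.cong)
  have "(\<Sum>i<k. row W i \<bullet> (B *\<^sub>v row W i)) = (\<Sum>i<k. \<Sum>b<n. W $$ (i, b) * (W * B) $$ (i, b))"
    by (simp add: rowW)
  \<comment> \<open>The swap passes from the rows of \<open>W\<close>, paired through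
    \<open>B\<close>, to its columns, paired through \<open>C\<close>.\<close>
  also have "\<dots> = (\<Sum>b<n. \<Sum>i<k. W $$ (i, b) * (W * B) $$ (i, b))" by (rule sum.swap)
  also have "\<dots> = (\<Sum>b<n. - (\<Sum>i<k. W $$ (i, b) * (C * W) $$ (i, b)))"
    using W C by (auto simp: eq sum_negf intro!: sum.cong)
  also have "\<dots> = - (\<Sum>b<n. col W b \<bullet> (C *\<^sub>v col W b))"
    by (simp add: colW sum_negf)
  also have "\<dots> \<le> 0" using C0 by (auto intro!: sum_nonneg)
  finally have "(\<Sum>i<k. row W i \<bullet> (B *\<^sub>v row W i)) = 0"
    using B0 sum_nonneg[of "{..<k}" "\<lambda>i. row W i \<bullet> (B *\<^sub>v row W i)"] by force
  hence "row W i \<bullet> (B *\<^sub>v row W i) = 0" if "i < k" for i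
    using B0 that by (subst (asm) sum_nonneg_eq_0_iff) auto
  hence "row W i = 0\<^sub>v n" if "i < k" for i
    using bnd[of "row W i"] W that by fastforce
  thus ?thesis using W by (intro eq_rowI) auto
qed

lemma pos_def_imp_semidef:
  assumes "pos_def_mat A" shows "pos_semidef_mat A"
  unfolding pos_semidef_mat_def
proof (intro conjI ballI)
  show "square_mat A" using assms by (simp add: pos_def_mat_def)
  fix v :: "real vec" assume v: "v \<in> carrier_vec (dim_row A)"
  show "0 \<le> v \<bullet> (A *\<^sub>v v)"
  proof (cases "v = 0\<^sub>v (dim_row A)")
    case True
    have "A *\<^sub>v v \<in> carrier_vec (dim_row A)" by (simp add: carrier_vecI)
    thus ?thesis using True by simp
  next
    case False
    thus ?thesis using assms v unfolding pos_def_mat_def by (simp add: less_imp_le)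
  qed
qed

text \<open>The difference \<open>W = K * B - C * K\<close> solves the Sylvester equation \<open>W * B + C * W = 0\<close>.\<close>

lemma square_intertwine:
  fixes B C K :: "real mat"
  assumes B: "B \<in> carrier_mat n n" "symmetric_mat B" "pos_def_mat B"
    and C: "C \<in> carrier_mat k k" "pos_semidef_mat C"
    and K: "K \<in> carrier_mat k n" and eq: "K * (B * B) = C * C * K"
  shows "K * B = C * K"
proof -
  define W where "W = K * B - C * K"
  have W: "W \<in> carrier_mat k n" using B C K by (auto simp: W_def)
  have "W * B = K * B * B - C * K * B"
    unfolding W_def using B C K by (intro minus_mult_distrib_mat[of _ k n]) auto
  \<comment> \<open>By \<open>eq\<close>, \<open>K * B * B\<close> is \<open>C * C * K\<close>; this
    is what makes \<open>W * B\<close> collapse to \<open>- (C * W)\<close>.\<close>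
  also have "K * B * B = C * (C * K)" using B C K eq by (simp add: assoc_mult_mat[of _ k n _ n _ n] assoc_mult_mat[of _ k k _ k _ n])
  also have "C * K * B = C * (K * B)" using B C K by simp
  also have "C * (C * K) - C * (K * B) = - (C * (K * B) - C * (C * K))"
    using B C K by (intro eq_matI) auto
  also have "C * (K * B) - C * (C * K) = C * W"
    unfolding W_def using B C K by (intro mult_minus_distrib_mat[symmetric, of _ k k _ n]) auto
  finally have "W = 0\<^sub>m k n" using sylvester_zero[OF B C W] by simp
  hence "K * B - C * K = 0\<^sub>m k n" by (simp add: W_def)
  hence ent: "(K * B - C * K) $$ (i, j) = 0" if "i < k" "j < n" for i j using that by simp
  show ?thesis
    by (rule eq_matI) (use ent B C K in auto)
qed

section \<open>Real eigenvectors of symmetric matrices\<close>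

text \<open>A complex eigenvector \<open>z\<close> exists; let \<open>x\<close> and \<open>y\<close>
  be its real and imaginary parts. Symmetry forces the eigenvalue to be real, after which
  \<open>x\<close> and \<open>y\<close> both satisfy the real eigenvector equation, and at least one
  of them is nonzero.\<close>

lemma real_symmetric_eigenvector:
  fixes A :: "real mat"
  assumes A: "A \<in> carrier_mat n n" "symmetric_mat A" and n: "n \<noteq> 0"
  obtains v a where "v \<in> carrier_vec n" "v \<noteq> 0\<^sub>v n" "A *\<^sub>v v = a \<cdot>\<^sub>v v"
proof -
  let ?A = "map_mat complex_of_real A"
  have "?A \<in> carrier_mat n n" using A by simp
  from spectrum_non_empty[OF this] n obtain k where "eigenvalue ?A k" unfolding spectrum_def by auto
  then obtain z where z: "z \<in> carrier_vec n" "z \<noteq> 0\<^sub>v n" "?A *\<^sub>v z = k \<cdot>\<^sub>v z"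
    unfolding eigenvalue_def eigenvector_def using A by auto
  define x y where "x = map_vec Re z" and "y = map_vec Im z"
  have xy: "x \<in> carrier_vec n" "y \<in> carrier_vec n" using z by (auto simp: x_def y_def)
  have ent: "(\<Sum>j<n. complex_of_real (A $$ (i, j)) * z $ j) = k * z $ i" if "i < n" for i
    using arg_cong[OF z(3), of "\<lambda>v. v $ i"] that A z(1) by (simp add: scalar_prod_def atLeast0LessThan)
  have Ax: "A *\<^sub>v x = Re k \<cdot>\<^sub>v x - Im k \<cdot>\<^sub>v y"
  proof (rule eq_vecI)
    fix i assume "i < dim_vec (Re k \<cdot>\<^sub>v x - Im k \<cdot>\<^sub>v y)"
    hence i: "i < n" using xy by simp
    show "(A *\<^sub>v x) $ i = (Re k \<cdot>\<^sub>v x - Im k \<cdot>\<^sub>v y) $ i"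
      using arg_cong[OF ent[OF i], of Re] i A z(1)
      by (simp add: scalar_prod_def atLeast0LessThan x_def y_def)
  qed (use A xy in auto)
  have Ay: "A *\<^sub>v y = Im k \<cdot>\<^sub>v x + Re k \<cdot>\<^sub>v y"
  proof (rule eq_vecI)
    fix i assume "i < dim_vec (Im k \<cdot>\<^sub>v x + Re k \<cdot>\<^sub>v y)"
    hence i: "i < n" using xy by simp
    show "(A *\<^sub>v y) $ i = (Im k \<cdot>\<^sub>v x + Re k \<cdot>\<^sub>v y) $ i"
      using arg_cong[OF ent[OF i], of Im] i A z(1)
      by (simp add: scalar_prod_def atLeast0LessThan x_def y_def)
  qed (use A xy in auto)
  \<comment> \<open>Expanding both sides with \<open>Ax\<close> and \<open>Ay\<close> cancels the
    \<open>Re k\<close> terms and leaves \<open>Im k\<close> times a sum of squared norms.\<close>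
  have "x \<bullet> (A *\<^sub>v y) = (A *\<^sub>v x) \<bullet> y"
    using transpose_vec_mult_scalar[OF A(1) xy(2) xy(1)] A(2)
      comm_scalar_prod[of _ n] xy A unfolding symmetric_mat_def by (metis mult_mat_vec_carrier)
  hence "Im k * (x \<bullet> x) + Re k * (x \<bullet> y) = Re k * (x \<bullet> y) - Im k * (y \<bullet> y)"
    using xy unfolding Ax Ay
    by (simp add: scalar_prod_add_distrib[of _ n] minus_scalar_prod_distrib[of _ n])
  hence im: "Im k * (x \<bullet> x + y \<bullet> y) = 0" by (simp add: algebra_simps)
  have xy0: "x \<noteq> 0\<^sub>v n \<or> y \<noteq> 0\<^sub>v n"
  proof (rule ccontr)
    assume "\<not> ?thesis"
    hence "Re (z $ i) = 0" "Im (z $ i) = 0" if "i < n" for i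
      using that z(1) by (auto simp: x_def y_def vec_eq_iff)
    hence "z = 0\<^sub>v n" using z(1) by (auto simp: vec_eq_iff complex_eq_iff)
    thus False using z by simp
  qed
  have "x \<bullet> x \<ge> 0" "y \<bullet> y \<ge> 0" by (simp_all add: scalar_prod_def sum_nonneg)
  hence "x \<bullet> x + y \<bullet> y > 0"
    using xy0 scalar_prod_self_pos xy by (metis add_nonneg_pos add_pos_nonneg)
  hence "Im k = 0" using im by simp
  hence "A *\<^sub>v x = Re k \<cdot>\<^sub>v x" "A *\<^sub>v y = Re k \<cdot>\<^sub>v y"
    unfolding Ax Ay using xy by auto
  thus ?thesis using that xy xy0 by blast
qed

section \<open>Block sums, congruence and orthonormal bases\<close>

text \<open>The quadratic form of a block diagonal matrix is the sum of the forms of its blocks;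
  vectors supported in a single block isolate one summand.\<close>

lemma pos_def_four_block_diag_iff:
  assumes A: "A \<in> carrier_mat n n" and B: "B \<in> carrier_mat k k"
  shows "pos_def_mat (four_block_mat A (0\<^sub>m n k) (0\<^sub>m k n) B) \<longleftrightarrow> pos_def_mat A \<and> pos_def_mat B"
    (is "pos_def_mat ?F \<longleftrightarrow> _")
proof -
  have F: "?F \<in> carrier_mat (n + k) (n + k)" using A B by simp
  have quad: "(a @\<^sub>v b) \<bullet> (?F *\<^sub>v (a @\<^sub>v b)) = a \<bullet> (A *\<^sub>v a) + b \<bullet> (B *\<^sub>v b)"
    if a: "a \<in> carrier_vec n" and b: "b \<in> carrier_vec k" for a b
  proof -
    have "?F *\<^sub>v (a @\<^sub>v b) = (A *\<^sub>v a) @\<^sub>v (B *\<^sub>v b)"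
      using a b A B by (subst four_block_mat_mult_vec[OF A _ _ B a b, of "0\<^sub>m n k" "0\<^sub>m k n"]) auto
    thus ?thesis using a b A B by (simp add: scalar_prod_append[of _ n _ k])
  qed
  have zero: "a @\<^sub>v b = 0\<^sub>v (n + k) \<longleftrightarrow> a = 0\<^sub>v n \<and> b = 0\<^sub>v k"
    if "a \<in> carrier_vec n" "b \<in> carrier_vec k" for a b :: "real vec"
  proof -
    have "(0\<^sub>v (n + k) :: real vec) = 0\<^sub>v n @\<^sub>v 0\<^sub>v k" by (intro eq_vecI) auto
    thus ?thesis using append_vec_eq[of a n "0\<^sub>v n" b "0\<^sub>v k"] that by auto
  qed
  show ?thesis
  proof
    assume pd: "pos_def_mat ?F"
    have pdD: "v \<bullet> (?F *\<^sub>v v) > 0" if "v \<in> carrier_vec (n + k)" "v \<noteq> 0\<^sub>v (n + k)" for v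
      using pd F that unfolding pos_def_mat_def by auto
    have "a \<bullet> (A *\<^sub>v a) > 0" if a: "a \<in> carrier_vec n" "a \<noteq> 0\<^sub>v n" for a
      using pdD[of "a @\<^sub>v 0\<^sub>v k"] quad[of a "0\<^sub>v k"] zero[of a "0\<^sub>v k"] a B by auto
    moreover have "b \<bullet> (B *\<^sub>v b) > 0" if b: "b \<in> carrier_vec k" "b \<noteq> 0\<^sub>v k" for b
      using pdD[of "0\<^sub>v n @\<^sub>v b"] quad[of "0\<^sub>v n" b] zero[of "0\<^sub>v n" b] b A by auto
    ultimately show "pos_def_mat A \<and> pos_def_mat B"
      using A B unfolding pos_def_mat_def by auto
  next
    assume pd: "pos_def_mat A \<and> pos_def_mat B"
    have A0: "a \<bullet> (A *\<^sub>v a) \<ge> 0" if "a \<in> carrier_vec n" for a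
      using pos_def_imp_semidef[of A] pd A that unfolding pos_semidef_mat_def by auto
    have B0: "b \<bullet> (B *\<^sub>v b) \<ge> 0" if "b \<in> carrier_vec k" for b
      using pos_def_imp_semidef[of B] pd B that unfolding pos_semidef_mat_def by auto
    have "v \<bullet> (?F *\<^sub>v v) > 0" if v: "v \<in> carrier_vec (n + k)" "v \<noteq> 0\<^sub>v (n + k)" for v
    proof -
      obtain a b where ab: "v = a @\<^sub>v b" "a \<in> carrier_vec n" "b \<in> carrier_vec k"
        using vec_first_last_append[OF v(1)] vec_first_carrier[of v n] vec_last_carrier[of v k] by metis
      with v zero have "a \<noteq> 0\<^sub>v n \<or> b \<noteq> 0\<^sub>v k" by blast
      hence "a \<bullet> (A *\<^sub>v a) > 0 \<or> b \<bullet> (B *\<^sub>v b) > 0"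
        using pd ab A B unfolding pos_def_mat_def by auto
      hence "a \<bullet> (A *\<^sub>v a) + b \<bullet> (B *\<^sub>v b) > 0"
        using A0[OF ab(2)] B0[OF ab(3)] by linarith
      thus ?thesis unfolding ab(1) quad[OF ab(2,3)] .
    qed
    thus "pos_def_mat ?F" using A B unfolding pos_def_mat_def by auto
  qed
qed

lemma symmetric_mat_index:
  "symmetric_mat A \<Longrightarrow> i < dim_row A \<Longrightarrow> j < dim_row A \<Longrightarrow> A $$ (i, j) = A $$ (j, i)"
  unfolding symmetric_mat_def by (metis index_transpose_mat(1,2))

lemma symmetric_mat_congruence:
  fixes A W :: "'a :: comm_semiring_0 mat"
  assumes "A \<in> carrier_mat n n" "symmetric_mat A" "W \<in> carrier_mat n k"
  shows "symmetric_mat (transpose_mat W * (A * W))"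
proof -
  have "transpose_mat (transpose_mat W * (A * W)) = transpose_mat (A * W) * W"
    using assms by (subst transpose_mult[of _ k n]) auto
  also have "transpose_mat (A * W) = transpose_mat W * A"
    using assms unfolding symmetric_mat_def by (subst transpose_mult[of _ n n]) auto
  finally show ?thesis using assms by (simp add: symmetric_mat_def)
qed

text \<open>The left inverse \<open>V\<close> makes \<open>W\<close> injective, and the new form at
  \<open>v\<close> is the form of \<open>A\<close> at \<open>W *\<^sub>v v\<close>.\<close>

lemma pos_def_mat_congruence:
  assumes A: "A \<in> carrier_mat n n" "pos_def_mat A"
    and W: "W \<in> carrier_mat n n" and V: "V \<in> carrier_mat n n" "V * W = 1\<^sub>m n"
  shows "pos_def_mat (transpose_mat W * (A * W))"
proof -
  have "v \<bullet> ((transpose_mat W * (A * W)) *\<^sub>v v) > 0" if v: "v \<in> carrier_vec n" "v \<noteq> 0\<^sub>v n" for v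
  proof -
    have "(V * W) *\<^sub>v v = v" using V v by simp
    hence "V *\<^sub>v (W *\<^sub>v v) = v" using V(1) W v by simp
    moreover have "V *\<^sub>v 0\<^sub>v n = 0\<^sub>v n" using V(1) by (intro eq_vecI) auto
    ultimately have "W *\<^sub>v v \<noteq> 0\<^sub>v n" using v by auto
    hence "(W *\<^sub>v v) \<bullet> (A *\<^sub>v (W *\<^sub>v v)) > 0"
      using A W v unfolding pos_def_mat_def by auto
    also have "(W *\<^sub>v v) \<bullet> (A *\<^sub>v (W *\<^sub>v v)) = v \<bullet> (transpose_mat W *\<^sub>v (A *\<^sub>v (W *\<^sub>v v)))"
      using transpose_vec_mult_scalar[of "transpose_mat W" n n "A *\<^sub>v (W *\<^sub>v v)" v] A W v by simp
    also have "\<dots> = v \<bullet> ((transpose_mat W * (A * W)) *\<^sub>v v)"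
      using A W v by (simp add: assoc_mult_mat_vec[of _ n n _ n])
    finally show ?thesis .
  qed
  thus ?thesis using A W unfolding pos_def_mat_def by auto
qed

text \<open>Complete \<open>v\<close> to a basis, orthogonalize by Gram-Schmidt and normalize. The
  first vector survives orthogonalization, so \<open>c\<close> is the reciprocal of the norm of
  \<open>v\<close>.\<close>

lemma real_orthogonal_with_first_col:
  fixes v :: "real vec"
  assumes v: "v \<in> carrier_vec n" "v \<noteq> 0\<^sub>v n"
  obtains W c where "W \<in> carrier_mat n n" "real_orthogonal_mat W" "col W 0 = c \<cdot>\<^sub>v v"
proof -
  interpret cof_vec_space n "TYPE(real)" .
  have n: "n > 0"
  proof (rule ccontr)
    assume "\<not> n > 0"
    hence "v = 0\<^sub>v n" using v by (intro eq_vecI) auto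
    thus False using v by simp
  qed
  define ws where "ws = gram_schmidt n (basis_completion v)"
  note bc = basis_completion[OF v]
  note gs = gram_schmidt_result[OF bc(2) bc(4) bc(5) ws_def]
  have len: "length ws = n" using gs(4) bc(6) by simp
  obtain vs where "basis_completion v = v # vs" by (simp add: basis_completion_def Let_def)
  hence "hd ws = v" using gram_schmidt_hd[OF v(1)] by (simp add: ws_def)
  hence hd: "ws ! 0 = v" using len n by (subst hd_conv_nth[symmetric]) auto
  have wsc: "ws ! i \<in> carrier_vec n" if "i < n" for i using gs(3) len that by auto
  \<comment> \<open>Conjugation is trivial over the reals, so \<open>corthogonal\<close> is ordinary
    orthogonality of nonzero vectors.\<close>
  have orth: "ws ! i \<bullet> ws ! j = 0 \<longleftrightarrow> i \<noteq> j" if "i < n" "j < n" for i j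
    using corthogonalD[OF gs(2), of i j] that len by simp
  have pos: "ws ! i \<bullet> ws ! i > 0" if "i < n" for i
    using orth[OF that that] scalar_prod_self_pos[OF wsc[OF that]] by fastforce
  define u where "u i = (1 / sqrt (ws ! i \<bullet> ws ! i)) \<cdot>\<^sub>v (ws ! i)" for i
  define W where "W = mat_of_cols n (map u [0..<n])"
  have W: "W \<in> carrier_mat n n" by (auto simp: W_def)
  have uc: "u i \<in> carrier_vec n" if "i < n" for i using wsc[OF that] by (simp add: u_def)
  have colW: "col W i = u i" if "i < n" for i
    unfolding W_def using that uc[OF that] by (subst col_mat_of_cols) auto
  have uu: "u i \<bullet> u j = (if i = j then 1 else 0)" if ij: "i < n" "j < n" for i j
  proof -
    have "u i \<bullet> u j = (1 / sqrt (ws ! i \<bullet> ws ! i)) * ((1 / sqrt (ws ! j \<bullet> ws ! j)) * (ws ! i \<bullet> ws ! j))"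
      unfolding u_def using wsc[OF ij(1)] wsc[OF ij(2)] by simp
    also have "\<dots> = (if i = j then 1 else 0)"
      using orth[OF ij] pos[OF ij(1)] by (auto simp: divide_simps)
    finally show ?thesis .
  qed
  have WW: "transpose_mat W * W = 1\<^sub>m n"
    by (rule eq_matI) (use W in \<open>auto simp: colW uu\<close>)
  have WW': "W * transpose_mat W = 1\<^sub>m n"
    by (rule mat_mult_left_right_inverse[OF _ W WW]) (use W in simp)
  have "real_orthogonal_mat W" using W WW WW' by (auto simp: real_orthogonal_mat_def)
  moreover have "col W 0 = (1 / sqrt (ws ! 0 \<bullet> ws ! 0)) \<cdot>\<^sub>v v"
    using colW[OF n] hd by (simp add: u_def)
  ultimately show ?thesis using that W by blast
qed

section \<open>Square roots of positive definite matrices\<close>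

text \<open>Induction on the dimension by deflation: in an orthonormal basis that starts with an
  eigenvector, \<open>A\<close> becomes block diagonal, with the eigenvalue and a smaller positive
  definite matrix as blocks. Roots of the two blocks are assembled and conjugated back.\<close>

lemma pos_def_sqrt_exists:
  fixes A :: "real mat"
  assumes "A \<in> carrier_mat n n" "symmetric_mat A" "pos_def_mat A"
  shows "\<exists>B \<in> carrier_mat n n. symmetric_mat B \<and> pos_def_mat B \<and> B * B = A"
  using assms
proof (induction n arbitrary: A)
  case 0
  thus ?case by (intro bexI[of _ A]) auto
next
  case (Suc n A)
  let ?n = "Suc n"
  note A = Suc.prems
  obtain v a where v: "v \<in> carrier_vec ?n" "v \<noteq> 0\<^sub>v ?n" "A *\<^sub>v v = a \<cdot>\<^sub>v v"
    using real_symmetric_eigenvector[OF A(1,2)] by blast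
  obtain W c where W: "W \<in> carrier_mat ?n ?n" "real_orthogonal_mat W" and col: "col W 0 = c \<cdot>\<^sub>v v"
    using real_orthogonal_with_first_col[OF v(1,2)] by metis
  have WW: "transpose_mat W * W = 1\<^sub>m ?n" "W * transpose_mat W = 1\<^sub>m ?n"
    using W unfolding real_orthogonal_mat_def by auto
  define N where "N = transpose_mat W * (A * W)"
  have N: "N \<in> carrier_mat ?n ?n" "symmetric_mat N" "pos_def_mat N"
    using symmetric_mat_congruence[OF A(1,2) W(1)] pos_def_mat_congruence[OF A(1,3) W(1) _ WW(1)] A W
    by (auto simp: N_def)
  have Acol: "A *\<^sub>v col W 0 = a \<cdot>\<^sub>v col W 0"
    using A(1) v by (simp add: col mult_mat_vec smult_smult_assoc mult.commute)
  \<comment> \<open>The first column of \<open>N\<close> is \<open>a\<close> times the first column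
    of \<open>transpose_mat W * W\<close>, that is, of the identity.\<close>
  have N0: "N $$ (i, 0) = (if i = 0 then a else 0)" if i: "i < ?n" for i
  proof -
    have "N $$ (i, 0) = col W i \<bullet> col (A * W) 0"
      using A W i by (simp add: N_def)
    also have "col (A * W) 0 = a \<cdot>\<^sub>v col W 0"
      by (rule trans[OF col_mult2[OF A(1) W(1)] Acol]) simp
    also have "col W i \<bullet> (a \<cdot>\<^sub>v col W 0) = a * (transpose_mat W * W) $$ (i, 0)"
      using W i by simp
    finally show ?thesis using i by (simp add: WW)
  qed
  define a1 where "a1 = mat 1 1 (\<lambda>_. a)"
  define D where "D = mat n n (\<lambda>(i, j). N $$ (Suc i, Suc j))"
  have a1: "a1 \<in> carrier_mat 1 1" and D: "D \<in> carrier_mat n n" by (auto simp: a1_def D_def)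
  \<comment> \<open>Symmetry of \<open>N\<close> carries the zeros of the first column over to the
    first row.\<close>
  have NB: "N = four_block_mat a1 (0\<^sub>m 1 n) (0\<^sub>m n 1) D"
    using N N0 symmetric_mat_index[OF N(2), of 0] by (intro eq_matI) (auto simp: a1_def D_def)
  have pdN: "pos_def_mat a1" "pos_def_mat D"
    using N(3) pos_def_four_block_diag_iff[OF a1 D] unfolding NB by auto
  have "symmetric_mat D"
    using symmetric_mat_index[OF N(2)] N(1) unfolding symmetric_mat_def
    by (intro eq_matI) (auto simp: D_def)
  from Suc.IH[OF D this pdN(2)] obtain E where
    E: "E \<in> carrier_mat n n" "symmetric_mat E" "pos_def_mat E" "E * E = D" by blast
  have "a > 0"
  proof -
    have "unit_vec 1 0 \<bullet> (a1 *\<^sub>v unit_vec 1 0) > 0"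
      using pdN(1) a1 unfolding pos_def_mat_def by (auto simp: unit_vec_nonzero simp del: scalar_prod_left_unit One_nat_def)
    thus ?thesis by (simp add: a1_def scalar_prod_def)
  qed
  define b1 where "b1 = mat 1 1 (\<lambda>_. sqrt a)"
  have b1: "b1 \<in> carrier_mat 1 1" "b1 * b1 = a1" "symmetric_mat b1"
    using \<open>a > 0\<close> by (auto simp: b1_def a1_def symmetric_mat_def scalar_prod_def intro!: eq_matI)
  have pdb: "pos_def_mat b1"
    unfolding pos_def_mat_def
  proof (intro conjI ballI impI)
    fix v :: "real vec" assume v: "v \<in> carrier_vec (dim_row b1)" "v \<noteq> 0\<^sub>v (dim_row b1)"
    hence "v $ 0 \<noteq> 0" by (auto simp: b1_def vec_eq_iff)
    moreover have "v \<bullet> (b1 *\<^sub>v v) = sqrt a * (v $ 0 * v $ 0)"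
      using v by (simp add: b1_def scalar_prod_def)
    ultimately show "v \<bullet> (b1 *\<^sub>v v) > 0" using \<open>a > 0\<close> by (simp add: zero_less_mult_iff) linarith
  qed (simp add: b1_def)
  define F where "F = four_block_mat b1 (0\<^sub>m 1 n) (0\<^sub>m n 1) E"
  have F: "F \<in> carrier_mat ?n ?n" "pos_def_mat F"
    using four_block_carrier_mat[OF b1(1) E(1)] pos_def_four_block_diag_iff[OF b1(1) E(1)] pdb E(3)
    by (auto simp: F_def)
  have "symmetric_mat F"
    using b1 E unfolding symmetric_mat_def F_def
    by (subst transpose_four_block_mat[of _ 1 1 _ n _ n]) auto
  have FF: "F * F = N"
    unfolding F_def NB using b1 E
    by (subst mult_four_block_mat[of _ 1 1 _ n _ n _ _ 1 _ n]) (auto simp: left_add_zero_mat[of _ 1 1] left_add_zero_mat[of _ n n])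
  define V where "V = transpose_mat W"
  have V: "V \<in> carrier_mat ?n ?n" "transpose_mat V = W" using W by (auto simp: V_def)
  define B where "B = W * (F * V)"
  have B: "B \<in> carrier_mat ?n ?n" "symmetric_mat B" "pos_def_mat B"
    using symmetric_mat_congruence[OF F(1) \<open>symmetric_mat F\<close> V(1)]
      pos_def_mat_congruence[OF F V(1) W(1)] WW V W F by (auto simp: B_def V_def)
  \<comment> \<open>\<open>V * W\<close> is the identity, so the inner factors cancel and
    \<open>B * B\<close> is \<open>W * N * V\<close>, which is \<open>A\<close>.\<close>
  have "B * B = W * (F * (V * (W * (F * V))))"
    unfolding B_def using W V F by (simp add: assoc_mult_mat[of _ ?n ?n _ ?n _ ?n])
  also have "V * (W * (F * V)) = V * W * (F * V)"
    using W V F by (simp add: assoc_mult_mat[of _ ?n ?n _ ?n _ ?n])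
  also have "V * W = 1\<^sub>m ?n" using WW by (simp add: V_def)
  also have "W * (F * (1\<^sub>m ?n * (F * V))) = W * (F * F * V)"
    using W V F by (simp add: assoc_mult_mat[of _ ?n ?n _ ?n _ ?n])
  also have "\<dots> = W * (V * (A * W) * V)" unfolding FF N_def V_def ..
  also have "\<dots> = (W * V) * A * (W * V)"
    using W V A by (simp add: assoc_mult_mat[of _ ?n ?n _ ?n _ ?n])
  also have "\<dots> = A" using A WW by (simp add: V_def)
  finally have "B * B = A" .
  with B show ?case by (intro bexI[of _ B] conjI)
qed

text \<open>\<open>psd_sqrt\<close> is a definite description, so uniqueness is required as well as
  existence. The positive definite root \<open>B\<close> is compared with any semidefinite root
  \<open>C\<close> by \<open>square_intertwine\<close> with the identity as
  \<open>K\<close>.\<close>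

lemma psd_sqrt_pos_def:
  assumes A: "A \<in> carrier_mat n n" "symmetric_mat A" "pos_def_mat A"
  shows "psd_sqrt A \<in> carrier_mat n n" "symmetric_mat (psd_sqrt A)" "pos_def_mat (psd_sqrt A)"
    "psd_sqrt A * psd_sqrt A = A"
proof -
  obtain B where B: "B \<in> carrier_mat n n" "symmetric_mat B" "pos_def_mat B" "B * B = A"
    using pos_def_sqrt_exists[OF A] by (elim bexE conjE)
  have "psd_sqrt A = B"
    unfolding psd_sqrt_def
  proof (rule the_equality)
    fix C assume C: "C \<in> carrier_mat (dim_row A) (dim_row A) \<and> symmetric_mat C \<and> pos_semidef_mat C \<and> C * C = A"
    have "1\<^sub>m n * B = C * 1\<^sub>m n"
      by (rule square_intertwine[of _ n]) (use C B A in auto)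
    moreover have "1\<^sub>m n * B = B" "C * 1\<^sub>m n = C" using A(1) B(1) C by auto
    ultimately show "C = B" by simp
  next
    show "B \<in> carrier_mat (dim_row A) (dim_row A) \<and> symmetric_mat B \<and> pos_semidef_mat B \<and> B * B = A"
      using A(1) B pos_def_imp_semidef[OF B(3)] by simp
  qed
  with B show "psd_sqrt A \<in> carrier_mat n n" "symmetric_mat (psd_sqrt A)" "pos_def_mat (psd_sqrt A)"
    "psd_sqrt A * psd_sqrt A = A" by auto
qed

section \<open>Symmetric orthogonal matrices from preconditioning\<close>

text \<open>A nonzero kernel vector would make the quadratic form vanish, so the determinant is
  nonzero and \<open>mat_inverse\<close> does not return \<open>None\<close>.\<close>

lemma pos_def_mat_inverse:
  assumes A: "A \<in> carrier_mat n n" "pos_def_mat A"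
  obtains B where "mat_inverse A = Some B"
proof -
  have "det A \<noteq> 0"
  proof
    assume "det A = 0"
    then obtain v where v: "v \<in> carrier_vec n" "v \<noteq> 0\<^sub>v n" "A *\<^sub>v v = 0\<^sub>v n"
      using det_0_iff_vec_prod_zero_field[OF A(1)] by auto
    hence "v \<bullet> (A *\<^sub>v v) > 0" using A by (auto simp: pos_def_mat_def)
    thus False using v by simp
  qed
  hence "A \<in> Units (ring_mat TYPE(real) n ())" by (rule det_non_zero_imp_unit[OF A(1)])
  hence "mat_inverse A \<noteq> None" using mat_inverse(1)[OF A(1), where b = "()"] by blast
  thus ?thesis using that by blast
qed

text \<open>The quadratic form of \<open>M\<close> at \<open>v\<close> is the squared norm of
  \<open>S *\<^sub>v v\<close> plus \<open>a\<^sup>2\<close> times that of \<open>v\<close>.\<close>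

lemma gram_shift_pos_def:
  fixes S :: "real mat"
  assumes S: "S \<in> carrier_mat k n" and a: "a \<noteq> 0"
  defines "M \<equiv> transpose_mat S * S + a\<^sup>2 \<cdot>\<^sub>m 1\<^sub>m n"
  shows "symmetric_mat M" "pos_def_mat M"
proof -
  have "symmetric_mat (transpose_mat S * (1\<^sub>m k * S))"
    by (rule symmetric_mat_congruence[of _ k]) (use S in \<open>auto simp: symmetric_mat_def\<close>)
  hence "transpose_mat (transpose_mat S * S) = transpose_mat S * S"
    using S by (simp add: symmetric_mat_def)
  moreover have "transpose_mat (a\<^sup>2 \<cdot>\<^sub>m 1\<^sub>m n) = a\<^sup>2 \<cdot>\<^sub>m 1\<^sub>m n" by (intro eq_matI) auto
  ultimately show "symmetric_mat M"
    unfolding symmetric_mat_def M_def using S by (subst transpose_add[of _ n n]) auto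
  have "v \<bullet> (M *\<^sub>v v) > 0" if v: "v \<in> carrier_vec n" "v \<noteq> 0\<^sub>v n" for v
  proof -
    have "M *\<^sub>v v = transpose_mat S *\<^sub>v (S *\<^sub>v v) + a\<^sup>2 \<cdot>\<^sub>v v"
    proof -
      have "(a\<^sup>2 \<cdot>\<^sub>m 1\<^sub>m n) *\<^sub>v v = a\<^sup>2 \<cdot>\<^sub>v v" using v by (intro eq_vecI) auto
      moreover have "M *\<^sub>v v = (transpose_mat S * S) *\<^sub>v v + (a\<^sup>2 \<cdot>\<^sub>m 1\<^sub>m n) *\<^sub>v v"
        unfolding M_def by (rule add_mult_distrib_mat_vec[of _ n n]) (use S v in auto)
      ultimately show ?thesis using S v by (simp add: assoc_mult_mat_vec[of _ n k _ n])
    qed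
    hence "v \<bullet> (M *\<^sub>v v) = v \<bullet> (transpose_mat S *\<^sub>v (S *\<^sub>v v)) + a\<^sup>2 * (v \<bullet> v)"
      using S v by (simp add: scalar_prod_add_distrib[of _ n])
    also have "v \<bullet> (transpose_mat S *\<^sub>v (S *\<^sub>v v)) = (S *\<^sub>v v) \<bullet> (S *\<^sub>v v)"
      using transpose_vec_mult_scalar[of "transpose_mat S" n k "S *\<^sub>v v" v] S v by simp
    also have "(S *\<^sub>v v) \<bullet> (S *\<^sub>v v) \<ge> 0" by (auto simp: scalar_prod_def intro!: sum_nonneg)
    hence "(S *\<^sub>v v) \<bullet> (S *\<^sub>v v) + a\<^sup>2 * (v \<bullet> v) > 0"
      using scalar_prod_self_pos[OF v] a by (intro add_nonneg_pos) auto
    finally show ?thesis .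
  qed
  thus "pos_def_mat M" using S unfolding pos_def_mat_def M_def by auto
qed

text \<open>Since \<open>A\<close> commutes with \<open>A * A = P * P\<close>,
  \<open>square_intertwine\<close> makes it commute with \<open>P\<close> itself, hence with
  \<open>P'\<close>. So \<open>P' * A\<close> is symmetric, and its square is
  \<open>P' * (P * P) * P'\<close>, the identity; a symmetric involution is orthogonal.\<close>

lemma preconditioned_symmetric_orthogonal:
  fixes P A :: "real mat"
  assumes P: "P \<in> carrier_mat n n" "symmetric_mat P" "pos_def_mat P"
    and A: "A \<in> carrier_mat n n" "symmetric_mat A" and sq: "P * P = A * A"
  obtains P' where "mat_inverse P = Some P'" "P' \<in> carrier_mat n n"
    "symmetric_mat (P' * A)" "real_orthogonal_mat (P' * A)"
proof -
  obtain P' where inv: "mat_inverse P = Some P'" using pos_def_mat_inverse[OF P(1,3)] .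
  note P' = mat_inverse(2)[OF P(1) inv]
  hence P'c: "P' \<in> carrier_mat n n" by simp
  have AP: "A * P = P * A"
  proof (rule square_intertwine[OF P P(1) pos_def_imp_semidef[OF P(3)] A(1)])
    show "A * (P * P) = P * P * A" unfolding sq using A by simp
  qed
  note assoc = assoc_mult_mat[of _ n n _ n _ n]
  \<comment> \<open>The transpose of \<open>P'\<close> is a left inverse of \<open>P\<close> and
    \<open>P'\<close> a right inverse, so the two coincide.\<close>
  have "transpose_mat P' * P = transpose_mat (P * P')"
    using P P' by (subst transpose_mult[of _ n n]) (auto simp: symmetric_mat_def)
  hence "transpose_mat P' * P = 1\<^sub>m n" using P' by simp
  hence "transpose_mat P' * (P * P') = 1\<^sub>m n * P'"
    using P P' by (metis assoc transpose_carrier_mat)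
  hence symP': "transpose_mat P' = P'"
    using P' by (metis left_mult_one_mat right_mult_one_mat transpose_carrier_mat)
  have AP': "A * P' = P' * A"
  proof -
    have "P' * A = P' * (A * (P * P'))" using P' A by simp
    also have "\<dots> = P' * (A * P * P')" using P P' A by (simp add: assoc)
    also have "\<dots> = (P' * P) * (A * P')" unfolding AP using P(1) P'c A(1) by (simp add: assoc)
    finally show ?thesis using P' A by simp
  qed
  have sym: "transpose_mat (P' * A) = P' * A"
    using P' A symP' AP' by (subst transpose_mult[of _ n n]) (auto simp: symmetric_mat_def)
  have "(P' * A) * (P' * A) = (P' * A) * (A * P')" by (simp add: AP')
  also have "\<dots> = P' * (A * A) * P'" using P' A by (simp add: assoc)
  also have "\<dots> = (P' * P) * (P * P')" unfolding sq[symmetric] using P P' by (simp add: assoc)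
  also have "\<dots> = 1\<^sub>m n" using P' by simp
  finally have "real_orthogonal_mat (P' * A)"
    using P' A sym by (auto simp: real_orthogonal_mat_def)
  moreover have "symmetric_mat (P' * A)" using sym by (simp add: symmetric_mat_def)
  ultimately show ?thesis using that inv P' by blast
qed

text \<open>Squaring the saddle-point matrix kills the off-diagonal blocks, because its diagonal
  blocks are opposite multiples of the identity, and leaves the two shifted Gram matrices on the
  diagonal. These are the squares of the blocks of \<open>P\<close>, so
  \<open>P * P = A * A\<close>.\<close>

lemma saddle_point_preconditioner:
  fixes S :: "real mat"
  assumes S: "S \<in> carrier_mat n n" and a: "a \<noteq> 0"
  defines "A \<equiv> four_block_mat (a \<cdot>\<^sub>m 1\<^sub>m n) (transpose_mat S) S (- (a \<cdot>\<^sub>m 1\<^sub>m n))"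
    and "P \<equiv> four_block_mat (psd_sqrt (transpose_mat S * S + a\<^sup>2 \<cdot>\<^sub>m 1\<^sub>m n)) (0\<^sub>m n n)
               (0\<^sub>m n n) (psd_sqrt (S * transpose_mat S + a\<^sup>2 \<cdot>\<^sub>m 1\<^sub>m n))"
  obtains P' where "mat_inverse P = Some P'" "P' \<in> carrier_mat (n + n) (n + n)"
    "symmetric_mat (P' * A)" "real_orthogonal_mat (P' * A)"
proof -
  define M1 where "M1 = transpose_mat S * S + a\<^sup>2 \<cdot>\<^sub>m 1\<^sub>m n"
  define M2 where "M2 = S * transpose_mat S + a\<^sup>2 \<cdot>\<^sub>m 1\<^sub>m n"
  have M: "M1 \<in> carrier_mat n n" "M2 \<in> carrier_mat n n" using S by (auto simp: M1_def M2_def)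
  have 1: "symmetric_mat M1" "pos_def_mat M1"
    unfolding M1_def by (rule gram_shift_pos_def[OF S a])+
  \<comment> \<open>The second block is the shifted Gram matrix of the transpose of
    \<open>S\<close>.\<close>
  have 2: "symmetric_mat M2" "pos_def_mat M2"
    unfolding M2_def using gram_shift_pos_def[of "transpose_mat S" n n, OF _ a] S by auto
  note R1 = psd_sqrt_pos_def[OF M(1) 1] and R2 = psd_sqrt_pos_def[OF M(2) 2]
  have Pdef: "P = four_block_mat (psd_sqrt M1) (0\<^sub>m n n) (0\<^sub>m n n) (psd_sqrt M2)"
    by (simp add: P_def M1_def M2_def)
  have P: "P \<in> carrier_mat (n + n) (n + n)" "pos_def_mat P"
    unfolding Pdef using R1 R2 pos_def_four_block_diag_iff[OF R1(1) R2(1)] by auto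
  have symP: "symmetric_mat P"
    using R1(1,2) R2(1,2) unfolding symmetric_mat_def Pdef
    by (subst transpose_four_block_mat[of _ n n _ n _ n]) auto
  have Ac: "A \<in> carrier_mat (n + n) (n + n)" using S by (simp add: A_def)
  have symA: "symmetric_mat A"
    using S unfolding symmetric_mat_def A_def
    by (subst transpose_four_block_mat[of _ n n _ n _ n]) (auto intro!: cong_four_block_mat eq_matI)
  have PP: "P * P = four_block_mat M1 (0\<^sub>m n n) (0\<^sub>m n n) M2"
    unfolding Pdef using R1 R2 M
    by (subst mult_four_block_mat[of _ n n _ n _ n _ _ n _ n])
      (auto simp: left_add_zero_mat[of _ n n])
  have scal: "X * (a \<cdot>\<^sub>m 1\<^sub>m n) = a \<cdot>\<^sub>m X" "(a \<cdot>\<^sub>m 1\<^sub>m n) * X = a \<cdot>\<^sub>m X"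
    "X * (- (a \<cdot>\<^sub>m 1\<^sub>m n)) = - (a \<cdot>\<^sub>m X)" "(- (a \<cdot>\<^sub>m 1\<^sub>m n)) * X = - (a \<cdot>\<^sub>m X)"
    if X: "X \<in> carrier_mat n n" for X
    using X mult_smult_distrib[OF X, of "1\<^sub>m n" n a] mult_smult_assoc_mat[of "1\<^sub>m n" n n X n a]
      uminus_mult_left_mat[of "a \<cdot>\<^sub>m 1\<^sub>m n" X] uminus_mult_right_mat[of X "a \<cdot>\<^sub>m 1\<^sub>m n"]
    by auto
  have "A * A = four_block_mat M1 (0\<^sub>m n n) (0\<^sub>m n n) M2"
    unfolding A_def using S
    apply (subst mult_four_block_mat[of _ n n _ n _ n _ _ n _ n])
           apply (auto simp: scal)
    apply (rule cong_four_block_mat)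
    apply (auto simp: M1_def M2_def power2_eq_square intro!: eq_matI)
    done
  with PP have "P * P = A * A" by simp
  from preconditioned_symmetric_orthogonal[OF P(1) symP P(2) Ac symA this] show ?thesis
    using that by metis
qed

section \<open>Toeplitz against circulant matrices, and Kronecker products\<close>

text \<open>On and below the diagonal both entries are \<open>c $ (i - j)\<close>. Above it the
  Toeplitz entry is zero and the circulant one wraps around to index
  \<open>dim_vec c + i - j\<close>, which lies beyond the bandwidth \<open>b\<close> outside the
  upper right corner of size \<open>b\<close>.\<close>

lemma lower_toeplitz_eq_circulant:
  assumes "i < dim_vec c" "j < dim_vec c"
    and "\<And>k. b < k \<Longrightarrow> k < dim_vec c \<Longrightarrow> c $ k = 0"
    and "b \<le> i \<or> j + b < dim_vec c"
  shows "lower_toeplitz_mat c $$ (i, j) = circulant_mat c $$ (i, j)"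
proof (cases "j \<le> i")
  case True
  hence "(int i - int j) mod int (dim_vec c) = int (i - j)"
    using assms True by (subst mod_pos_pos_trivial) auto
  hence "nat ((int i - int j) mod int (dim_vec c)) = i - j" by simp
  thus ?thesis using assms True by (simp add: lower_toeplitz_mat_def circulant_mat_def)
next
  case False
  have "(int i - int j) mod int (dim_vec c) = (int i - int j + int (dim_vec c)) mod int (dim_vec c)"
    by simp
  also have "\<dots> = int (dim_vec c + i - j)"
    using assms False by (subst mod_pos_pos_trivial) auto
  finally have "nat ((int i - int j) mod int (dim_vec c)) = dim_vec c + i - j" by simp
  \<comment> \<open>The wrapped index exceeds \<open>b\<close> either through
    \<open>b \<le> i\<close>, as \<open>j < dim_vec c\<close>, or through
    \<open>j + b < dim_vec c\<close>.\<close>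
  moreover have "c $ (dim_vec c + i - j) = 0"
    using assms False by (intro assms(3)) auto
  ultimately show ?thesis using assms False
    by (simp add: lower_toeplitz_mat_def circulant_mat_def)
qed

lemma kron_mat_index:
  assumes "i < dim_row A * dim_row B" "j < dim_col A * dim_col B"
  shows "(A \<otimes>\<^sub>k B) $$ (i, j) =
    A $$ (i div dim_row B, j div dim_col B) * B $$ (i mod dim_row B, j mod dim_col B)"
  using assms by (simp add: kron_mat_def)

lemma kron_mat_dim:
  "dim_row (A \<otimes>\<^sub>k B) = dim_row A * dim_row B" "dim_col (A \<otimes>\<^sub>k B) = dim_col A * dim_col B"
  by (simp_all add: kron_mat_def)

lemma kron_mat_carrier:
  "A \<in> carrier_mat r c \<Longrightarrow> B \<in> carrier_mat s d \<Longrightarrow> A \<otimes>\<^sub>k B \<in> carrier_mat (r * s) (c * d)"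
  by (intro carrier_matI) (auto simp: kron_mat_dim)

text \<open>Lets identity blocks be compared entrywise with the Kronecker forms of
  \<open>I_hat\<close> and \<open>I_check\<close>.\<close>

lemma kron_one_one: "(1\<^sub>m n :: 'a :: semiring_1 mat) \<otimes>\<^sub>k 1\<^sub>m m = 1\<^sub>m (n * m)"
proof (rule eq_matI)
  fix i j assume "i < dim_row (1\<^sub>m (n * m) :: 'a mat)" "j < dim_col (1\<^sub>m (n * m) :: 'a mat)"
  hence ij: "i < n * m" "j < n * m" by auto
  hence "m > 0" by (auto intro: Nat.gr0I)
  moreover have "i div m < n" "j div m < n" using ij by (auto simp: less_mult_imp_div_less)
  moreover have "i = j \<longleftrightarrow> i div m = j div m \<and> i mod m = j mod m"
    by (metis div_mult_mod_eq)
  ultimately show "((1\<^sub>m n :: 'a mat) \<otimes>\<^sub>k 1\<^sub>m m) $$ (i, j) = 1\<^sub>m (n * m) $$ (i, j)"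
    using ij by (auto simp: kron_mat_index)
qed (auto simp: kron_mat_dim)

lemma B1_eq_S1:
  assumes "i < n" "j < n" "2 \<le> i \<or> j + 2 < n"
  shows "B1 n $$ (i, j) = S1 n $$ (i, j)"
  unfolding B1_def S1_def
  by (rule lower_toeplitz_eq_circulant[where b = 2]) (use assms in \<open>auto simp: col1_def\<close>)

lemma B2_eq_S2:
  assumes "i < n" "j < n" "2 \<le> i \<or> j + 2 < n"
  shows "B2 n $$ (i, j) = S2 n $$ (i, j)"
  unfolding B2_def S2_def
  by (rule lower_toeplitz_eq_circulant[where b = 2]) (use assms in \<open>auto simp: col2_def\<close>)


section \<open>Splitting the preconditioned system and locating the remainder\<close>

theorem theorem3p9:
  fixes m n :: nat
    and \<Delta> \<T> \<A> S \<P> :: "real mat"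
    and T \<gamma> \<tau> \<alpha> :: real
  assumes "m \<ge> 1" and "n \<ge> 3"
    and "\<Delta> \<in> carrier_mat m m"
    and "symmetric_mat (- \<Delta>)" and "pos_def_mat (- \<Delta>)"
    and "T > 0" and "\<gamma> > 0"
    and "\<tau> = T / real n" and "\<alpha> = \<tau>\<^sup>2 / sqrt \<gamma>"
    and "\<T> = (B1 n \<otimes>\<^sub>k 1\<^sub>m m) - (\<tau>\<^sup>2 / 2) \<cdot>\<^sub>m (B2 n \<otimes>\<^sub>k \<Delta>)"
    and "\<A> = four_block_mat
           (\<alpha> \<cdot>\<^sub>m (I_check n \<otimes>\<^sub>k 1\<^sub>m m)) (transpose_mat \<T>)
           \<T>                           (- (\<alpha> \<cdot>\<^sub>m (I_hat n \<otimes>\<^sub>k 1\<^sub>m m)))"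
    and "S = (S1 n \<otimes>\<^sub>k 1\<^sub>m m) - (\<tau>\<^sup>2 / 2) \<cdot>\<^sub>m (S2 n \<otimes>\<^sub>k \<Delta>)"
    and "\<P> = four_block_mat
           (psd_sqrt (transpose_mat S * S + \<alpha>\<^sup>2 \<cdot>\<^sub>m 1\<^sub>m (m * n))) (0\<^sub>m (m * n) (m * n))
           (0\<^sub>m (m * n) (m * n)) (psd_sqrt (S * transpose_mat S + \<alpha>\<^sup>2 \<cdot>\<^sub>m 1\<^sub>m (m * n)))"
  shows "\<exists>\<P>inv Q R.
           mat_inverse \<P> = Some \<P>inv \<and>
           Q \<in> carrier_mat (2 * (m * n)) (2 * (m * n)) \<and>
           R \<in> carrier_mat (2 * (m * n)) (2 * (m * n)) \<and>
           \<P>inv * \<A> = Q + R \<and>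
           symmetric_mat Q \<and> real_orthogonal_mat Q \<and>
           vec_space.rank (2 * (m * n)) R \<le> 8 * m"
  proof -
  note n = assms(2) and \<Delta> = assms(3)
  note \<T> = assms(10) and \<A> = assms(11) and S = assms(12) and \<P> = assms(13)
  \<comment> \<open>The common size of the four blocks; \<open>kron_mat\<close> yields it as
    \<open>n * m\<close>, and \<open>kron\<close> and \<open>index\<close> absorb the
    commutation.\<close>
  define N where "N = m * n"
  have m0: "m > 0" using assms(1) by simp
  \<comment> \<open>The nonzero shift makes both diagonal blocks of \<open>\<P>\<close> positive
    definite.\<close>
  have \<alpha>: "\<alpha> \<noteq> 0" using assms(2,6-9) by simp
  have dims: "B1 n \<in> carrier_mat n n" "B2 n \<in> carrier_mat n n" "S1 n \<in> carrier_mat n n"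
    "S2 n \<in> carrier_mat n n" "I_hat n \<in> carrier_mat n n" "I_check n \<in> carrier_mat n n"
    by (auto simp: B1_def B2_def S1_def S2_def I_hat_def I_check_def lower_toeplitz_mat_def
        circulant_mat_def col1_def col2_def)
  have kron: "K \<otimes>\<^sub>k L \<in> carrier_mat N N"
    if "K \<in> carrier_mat n n" "L \<in> carrier_mat m m" for K L :: "real mat"
    using kron_mat_carrier[OF that] by (simp add: N_def mult.commute)
  have index: "(K \<otimes>\<^sub>k L) $$ (i, j) = K $$ (i div m, j div m) * L $$ (i mod m, j mod m)"
    if "K \<in> carrier_mat n n" "L \<in> carrier_mat m m" "i < N" "j < N" for K L :: "real mat" and i j
    using that kron_mat_index[of i K L j] by (auto simp: N_def mult.commute)
  have divn: "i div m < n" if "i < N" for i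
    using that by (simp add: N_def less_mult_imp_div_less mult.commute)
  have carr: "\<T> \<in> carrier_mat N N" "S \<in> carrier_mat N N"
    unfolding \<T> S using kron dims \<Delta> by (auto intro!: minus_carrier_mat)
  have entry: "(K \<otimes>\<^sub>k 1\<^sub>m m - c \<cdot>\<^sub>m (L \<otimes>\<^sub>k \<Delta>)) $$ (i, j) =
      K $$ (i div m, j div m) * 1\<^sub>m m $$ (i mod m, j mod m)
      - c * (L $$ (i div m, j div m) * \<Delta> $$ (i mod m, j mod m))"
    if "K \<in> carrier_mat n n" "L \<in> carrier_mat n n" "i < N" "j < N" for K L c i j
    using carrier_matD[OF kron[OF that(2) \<Delta>]] that \<Delta> index[OF that(1) _ that(3,4), of "1\<^sub>m m"]
      index[OF that(2) \<Delta> that(3,4)] by simp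
  \<comment> \<open>The two matrices can differ only where the block row is 0 or 1 and the block
    column is one of the last two.\<close>
  have \<T>S: "\<T> $$ (i, j) = S $$ (i, j)"
    if "i < N" "j < N" "2 \<le> i div m \<or> j div m + 2 < n" for i j
    unfolding \<T> S using that dims divn
    by (simp only: entry B1_eq_S1[of "i div m" n "j div m"] B2_eq_S2[of "i div m" n "j div m"])
  define A where "A = four_block_mat (\<alpha> \<cdot>\<^sub>m 1\<^sub>m N) (transpose_mat S) S (- (\<alpha> \<cdot>\<^sub>m 1\<^sub>m N))"
  obtain P' where inv: "mat_inverse \<P> = Some P'" and P': "P' \<in> carrier_mat (N + N) (N + N)"
    and Q: "symmetric_mat (P' * A)" "real_orthogonal_mat (P' * A)"
    using saddle_point_preconditioner[OF carr(2) \<alpha>] unfolding A_def \<P> N_def by blast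
  have A: "A \<in> carrier_mat (N + N) (N + N)" using carr by (simp add: A_def)
  have \<A>c: "\<A> \<in> carrier_mat (N + N) (N + N)"
    unfolding \<A> using kron dims by (intro four_block_carrier_mat) auto
  define R where "R = P' * (\<A> - A)"
  have Rc: "R \<in> carrier_mat (N + N) (N + N)" unfolding R_def by (rule mult_carrier_mat[OF P' minus_carrier_mat[OF A]])
  have split: "P' * \<A> = P' * A + R"
    unfolding R_def mult_minus_distrib_mat[OF P' \<A>c A] using P' A \<A>c by (intro eq_matI) auto
  \<comment> \<open>Before \<open>N\<close> lie the last two block columns of the left half, with
    the corner of \<open>\<T>\<close> and the halved block of \<open>I_check\<close>; from
    \<open>N\<close> on lie the first two of the right half, with the transposed corner and the
    halved block of \<open>I_hat\<close>. As \<open>n \<ge> 3\<close>, the truncated subtraction is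
    exact.\<close>
  define J where "J = {N - 2 * m..<N + 2 * m}"
  have one: "(1\<^sub>m N :: real mat) = 1\<^sub>m n \<otimes>\<^sub>k 1\<^sub>m m" by (simp add: kron_one_one N_def mult.commute)
  have \<A>A: "\<A> $$ (i, j) = A $$ (i, j)" if i: "i < N + N" and j: "j < N + N" "j \<notin> J" for i j
  proof (cases "j < N")
    case True
    \<comment> \<open>Thus \<open>j\<close> misses the last two block columns, in particular the
      last one, where \<open>I_check\<close> has \<open>1/2\<close>.\<close>
    hence "j < (n - 2) * m" using j by (auto simp: J_def N_def diff_mult_distrib2 mult.commute)
    hence jn: "j div m + 2 < n" using less_mult_imp_div_less by fastforce
    have "I_check n $$ (i div m, j div m) = 1\<^sub>m n $$ (i div m, j div m)" if "i < N"
      using jn divn[OF that] by (auto simp: I_check_def)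
    hence "(I_check n \<otimes>\<^sub>k 1\<^sub>m m) $$ (i, j) = (1\<^sub>m N :: real mat) $$ (i, j)" if "i < N"
      unfolding one using that True dims by (subst (1 2) index) auto
    moreover have "\<T> $$ (i - N, j) = S $$ (i - N, j)" if "\<not> i < N"
      using \<T>S[of "i - N" j] that i True jn by auto
    ultimately show ?thesis
      using i True carr kron[OF dims(6), of "1\<^sub>m m"] kron[OF dims(5), of "1\<^sub>m m"]
      unfolding \<A> A_def by auto
  next
    case False
    define k where "k = j - N"
    have "2 * m \<le> k" and k: "k < N" using False j by (auto simp: J_def k_def)
    with m0 div_le_mono[of "2 * m" k m] have k2: "2 \<le> k div m" by simp
    have "I_hat n $$ (i div m, k div m) = 1\<^sub>m n $$ (i div m, k div m)" if "i < N" for i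
      using k2 divn[OF that] divn[OF k] by (auto simp: I_hat_def)
    hence "(I_hat n \<otimes>\<^sub>k 1\<^sub>m m) $$ (i, k) = (1\<^sub>m N :: real mat) $$ (i, k)" if "i < N" for i
      unfolding one using that k dims by (subst (1 2) index) auto
    \<comment> \<open>The upper right block is the transpose of \<open>\<T>\<close>, so its column
      \<open>k\<close> is a row of \<open>\<T>\<close>, and block row at least 2 avoids the
      corner.\<close>
    moreover have "\<T> $$ (k, i) = S $$ (k, i)" if "i < N"
      using \<T>S[of k i] that k k2 by auto
    ultimately show ?thesis
      using i j False k carr kron[OF dims(6), of "1\<^sub>m m"] kron[OF dims(5), of "1\<^sub>m m"]
      unfolding \<A> A_def by (auto simp: k_def[symmetric])
  qed
  have "col R j = 0\<^sub>v (N + N)" if j: "j < N + N" "j \<notin> J" for j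
  proof -
    \<comment> \<open>Left multiplication by \<open>P'\<close> preserves zero columns, so it
      suffices to look at the unpreconditioned difference.\<close>
    have "col (\<A> - A) j = 0\<^sub>v (N + N)"
      using \<A>A[OF _ j] \<A>c A j by (intro eq_vecI) auto
    hence "col R j = P' *\<^sub>v 0\<^sub>v (N + N)"
      unfolding R_def using P' A j by (subst col_mult2[of _ "N + N" "N + N" _ "N + N"]) auto
    thus ?thesis using P' by (intro eq_vecI) auto
  qed
  hence "vec_space.rank (N + N) R \<le> card J"
    by (intro rank_le_card_nonzero_cols[OF Rc]) (auto simp: J_def)
  \<comment> \<open>\<open>J\<close> has \<open>4 * m\<close> elements, half of what the bound
    allows.\<close>
  also have "card J \<le> 8 * m" by (simp add: J_def)
  finally have "vec_space.rank (N + N) R \<le> 8 * m" .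
  moreover have "P' * A \<in> carrier_mat (N + N) (N + N)" using P' A by simp
  ultimately show ?thesis
    using inv Rc split Q unfolding N_def mult_2 by blast
qed

end
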